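(* Let $B\subseteq \mathbb{N}^+$ be an infinite set with increasing enumeration $(b_n: n \in \mathbb{N}^+)$ and suppose that $$\liminf_{n\to \infty}\frac{b_{n+1}}{b_n}>1.$$ Let also $C\subseteq \mathbb{N}$ be a nonempty finite set. Then for each $\alpha \in [0,1]$ there exists a set $A\subseteq \mathbb{N}^+$ such that $\mathsf{d}(A)=0$ and $\mathsf{d}(A+B+C)=\alpha$.
   Context: $\mathbb{N}^+=\{1,2,\ldots\}$ and $\mathbb{N}=\{0,1,2,\ldots\}$. For $S\subseteq \mathbb{N}^+$, the asymptotic density is $\mathsf{d}(S):=\lim_{n\to\infty} |S\cap[1,n]|/n$, provided the limit exists; "$\mathsf{d}(S)=\alpha$" means that the limit exists and equals $\alpha$. The sumset is $A+B+C:=\{x+y+z: x\in A, y\in B, z\in C\}$. *)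

theory Defs
  imports
    Complex_Main
    "HOL-Library.Infinite_Set"
    "HOL-Library.Extended_Real"
    "HOL-Library.Liminf_Limsup"
    "HOL-Library.Set_Algebras"
begin

definition has_asymptotic_density :: "nat set \<Rightarrow> real \<Rightarrow> bool"
  where "has_asymptotic_density S \<alpha> \<longleftrightarrow>
    (\<lambda>n. real (card (S \<inter> {1..n})) / real n) \<longlonglongrightarrow> \<alpha>"

end

theory Submission
  imports Defs
begin

text \<open>
  Put \<open>D = B + C\<close>. Two greedy constructions are applied one after the other.

  First, a set \<open>A0\<close> of density zero is found for which \<open>A0 + D\<close> has density one: running through
  \<open>a = 1, 2, \<dots>\<close>, accept \<open>a\<close> iff at least \<open>h a\<close> of the translates of \<open>a\<close> by the first \<open>(h a)\<^sup>2\<close>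
  elements of \<open>D\<close> are not yet covered, where \<open>h\<close> tends to infinity very slowly. Accepted elements
  cover at least \<open>h a\<close> new points each, so they are rare; an uncovered point lies in about \<open>h\<^sup>2\<close>
  translate sets, each of which contains at most \<open>h\<close> uncovered points, so these are rare as well.

  Second, \<open>A0\<close> is thinned: accept \<open>a \<in> A0\<close> iff \<open>A + D\<close> has so far at most \<open>\<alpha> a\<close> elements up to \<open>a\<close>.
  By lacunarity only boundedly many elements of \<open>D\<close> lie in \<open>(\<epsilon> n, n]\<close>, and since \<open>A0\<close> has density zero,
  all but \<open>o(n)\<close> elements of \<open>A0 + D\<close> up to \<open>n\<close> are of the form \<open>a + d\<close> with \<open>d \<le> \<epsilon> n\<close>. Hence the
  counting function of \<open>A + D\<close> reacts to accepting or rejecting with a delay of at most \<open>\<epsilon> n\<close>, and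
  stays within \<open>o(n)\<close> of \<open>\<alpha> n\<close>.
\<close>

section \<open>Greedy recursion and density criteria\<close>

text \<open>The decision about \<open>a\<close> consults only smaller members, so well-founded
  recursion along < produces the set. Both greedy constructions are instances.\<close>

lemma online_set_exists:
  fixes P :: "nat \<Rightarrow> nat set \<Rightarrow> bool"
  obtains A where "\<And>a. a \<in> A \<longleftrightarrow> P a (A \<inter> {..<a})"
proof -
  define G where "G f a \<longleftrightarrow> P a {x. x < a \<and> f x}" for f :: "nat \<Rightarrow> bool" and a
  define g where "g = wfrec less_than G"
  have adm: "adm_wf less_than G"
    unfolding adm_wf_def G_def by (auto cong: conj_cong)
  have g: "g a \<longleftrightarrow> P a {x. x < a \<and> g x}" for a
  proof -
    have "g = G g" unfolding g_def by (rule wfrec_fixpoint[OF wf_less_than adm])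
    then have "g a = G g a" by (rule fun_cong)
    then show ?thesis unfolding G_def .
  qed
  show thesis
  proof (rule that)
    fix a
    have "{x. x < a \<and> g x} = Collect g \<inter> {..<a}" by auto
    then show "a \<in> Collect g \<longleftrightarrow> P a (Collect g \<inter> {..<a})" using g[of a] by simp
  qed
qed

lemma has_asymptotic_densityI:
  assumes "\<And>e. e > 0 \<Longrightarrow>
    \<forall>\<^sub>F n in sequentially. \<bar>real (card (S \<inter> {1..n})) - \<alpha> * real n\<bar> \<le> e * real n"
  shows "has_asymptotic_density S \<alpha>"
  unfolding has_asymptotic_density_def
proof (rule tendstoI)
  fix e :: real assume "e > 0"
  with assms[of "e/2"] have "\<forall>\<^sub>F n in sequentially.
      \<bar>real (card (S \<inter> {1..n})) - \<alpha> * real n\<bar> \<le> e/2 * real n" by simp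
  then show "\<forall>\<^sub>F n in sequentially. dist (real (card (S \<inter> {1..n})) / real n) \<alpha> < e"
    using eventually_gt_at_top[of 0]
  proof eventually_elim
    case (elim n)
    then have "real (card (S \<inter> {1..n})) / real n - \<alpha>
        = (real (card (S \<inter> {1..n})) - \<alpha> * real n) / real n"
      by (simp add: field_simps)
    then have "dist (real (card (S \<inter> {1..n})) / real n) \<alpha>
        = \<bar>real (card (S \<inter> {1..n})) - \<alpha> * real n\<bar> / real n"
      by (simp add: dist_real_def)
    also have "\<dots> \<le> e/2" using elim by (simp add: field_simps)
    finally show ?case using \<open>e > 0\<close> by simp
  qed
qed

lemma density_zeroD:
  assumes "has_asymptotic_density S 0" "e > 0"
  shows "\<forall>\<^sub>F n in sequentially. real (card (S \<inter> {1..n})) \<le> e * real n"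
proof -
  have "\<forall>\<^sub>F n in sequentially. dist (real (card (S \<inter> {1..n})) / real n) 0 < e"
    using assms tendstoD unfolding has_asymptotic_density_def by blast
  then show ?thesis using eventually_gt_at_top[of 0]
    by eventually_elim (simp add: field_simps)
qed

text \<open>The bound gives a proportion of at most \<open>K / h n\<close>, which tends to 0; the
  product form avoids dividing by \<open>h n = 0\<close>.\<close>

lemma density_zero_if_slow_bound:
  fixes h :: "nat \<Rightarrow> nat"
  assumes h: "filterlim h at_top sequentially"
    and bound: "\<And>n. h n * card (S \<inter> {1..n}) \<le> K * n"
  shows "has_asymptotic_density S 0"
proof (rule has_asymptotic_densityI)
  fix e :: real assume e: "e > 0"
  have "\<forall>\<^sub>F n in sequentially. h n \<ge> Suc (nat \<lceil>K / e\<rceil>)"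
    using h by (simp add: filterlim_at_top)
  then show "\<forall>\<^sub>F n in sequentially. \<bar>real (card (S \<inter> {1..n})) - 0 * real n\<bar> \<le> e * real n"
  proof eventually_elim
    case (elim n)
    then have "K / e \<le> h n" "h n > 0" by linarith+
    then have "K \<le> e * h n" using e by (simp add: field_simps)
    have "real (h n) * card (S \<inter> {1..n}) \<le> K * real n"
      using bound[of n] by (metis of_nat_le_iff of_nat_mult)
    also have "\<dots> \<le> e * h n * n"
      using \<open>K \<le> e * h n\<close> by (simp add: mult_right_mono)
    finally have "real (h n) * card (S \<inter> {1..n}) \<le> h n * (e * n)" by (simp add: ac_simps)
    then show ?case using \<open>h n > 0\<close> by simp
  qed
qed

section \<open>A thin set whose sumset has density one\<close>

text \<open>The third property keeps the chosen translates of \<open>a\<close> below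
  \<open>2 * a\<close>. The fourth makes the initial segment up to \<open>n\<close> negligible,
  while \<open>h\<close> loses at most 1 between \<open>x\<close> and \<open>n\<close>.\<close>

lemma slow_growth_exists:
  fixes d :: "nat \<Rightarrow> nat"
  assumes "strict_mono d"
  obtains h :: "nat \<Rightarrow> nat" where "mono h" "filterlim h at_top sequentially"
    "\<And>a i. i < (h a)\<^sup>2 \<Longrightarrow> d i \<le> a"
    "\<And>x. \<exists>n. (h x - 1) * n \<le> x \<and> h x - 1 \<le> h n"
proof -
  \<comment> \<open>The factorial makes \<open>c i / c (i + 1)\<close> tend to 0, so that \<open>h\<close> is almost constant on long ranges.\<close>
  define c where "c i = fact i * d ((Suc i)\<^sup>2)" for i
  define h where "h x = (LEAST i. x < c i)" for x
  have d_ge: "i \<le> d i" for i using assms by (rule strict_mono_imp_increasing)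
  have c_d: "d ((Suc i)\<^sup>2) \<le> c i" for i unfolding c_def by simp
  have c_gt: "i < c i" for i
  proof -
    have "i < (Suc i)\<^sup>2" by (simp add: power2_eq_square)
    then show ?thesis using d_ge[of "(Suc i)\<^sup>2"] c_d[of i] by linarith
  qed
  have c_Suc: "Suc i * c i \<le> c (Suc i)" for i
  proof -
    have "d ((Suc i)\<^sup>2) \<le> d ((Suc (Suc i))\<^sup>2)"
      using assms by (simp add: strict_mono_less_eq)
    then show ?thesis unfolding c_def by (simp only: fact_Suc of_nat_id mult.assoc mult_le_mono le_refl)
  qed
  have mono_c: "mono c"
  proof (rule mono_iff_le_Suc[THEN iffD2], intro allI)
    fix i show "c i \<le> c (Suc i)" using c_Suc[of i] by (simp add: add_leD1)
  qed
  have h2: "x < c (h x)" for x unfolding h_def using c_gt by (rule LeastI)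
  have h1: "c j \<le> x" if "j < h x" for j x
    using that not_less_Least unfolding h_def by fastforce
  have h3: "j < h x" if "c j \<le> x" for j x
    using that h2[of x] monoD[OF mono_c, of "h x" j] by (meson leD le_less_linear le_trans)
  show thesis
  proof (rule that)
    show "mono h"
    proof (rule monoI, rule ccontr)
      fix x y :: nat assume "x \<le> y" "\<not> h x \<le> h y"
      then show False using h1[of "h y" x] h2[of y] by linarith
    qed
    show "filterlim h at_top sequentially"
      unfolding filterlim_at_top eventually_sequentially using h3 less_imp_le
      by meson
    show "d i \<le> a" if i: "i < (h a)\<^sup>2" for a i
    proof -
      obtain j where j: "h a = Suc j" using i by (cases "h a") auto
      have "d i \<le> d ((Suc j)\<^sup>2)" using i assms j by (simp add: strict_mono_less_eq)
      then show ?thesis using c_d[of j] h1[of j a] j by simp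
    qed
    show "\<exists>n. (h x - 1) * n \<le> x \<and> h x - 1 \<le> h n" for x
    proof (cases "h x - 1")
      case 0 then show ?thesis by simp
    next
      case (Suc j)
      \<comment> \<open>Here \<open>h x = j + 2\<close>. The witness is \<open>n = c j\<close>: it
        is smaller than \<open>x\<close> by the factor \<open>Suc j\<close>, and \<open>h\<close>
        there is already at least \<open>Suc j\<close>.\<close>
      then have "c (Suc j) \<le> x" using h1[of "Suc j" x] by simp
      moreover have "j < h (c j)" using h3 by simp
      ultimately show ?thesis using c_Suc[of j] Suc by (intro exI[of _ "c j"]) auto
    qed
  qed
qed

lemma thin_complement_exists:
  fixes D :: "nat set"
  assumes D: "D \<subseteq> {1..}" "infinite D"
  obtains A where "A \<subseteq> {1..}" "has_asymptotic_density A 0"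
    "has_asymptotic_density (- (A + D)) 0"
proof -
  define d where "d = enumerate D"
  have d: "strict_mono d" unfolding d_def using D(2) by (rule strict_mono_enumerate)
  have dD: "d i \<in> D" for i unfolding d_def using D(2) by (rule enumerate_in_set)
  obtain h where h: "mono h" "filterlim h at_top sequentially"
    "\<And>a i. i < (h a)\<^sup>2 \<Longrightarrow> d i \<le> a"
    "\<And>x. \<exists>n. (h x - 1) * n \<le> x \<and> h x - 1 \<le> h n"
    using slow_growth_exists[OF d] by metis
  define F where "F a = d ` {..<(h a)\<^sup>2}" for a
  have F_fin [simp]: "finite (F a)" for a by (simp add: F_def)
  have F_D: "F a \<subseteq> D" for a using dD by (auto simp: F_def)
  have F_le: "f \<le> a" if "f \<in> F a" for f a using that h(3) by (auto simp: F_def)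
  have F_card: "card (F a) = (h a)\<^sup>2" for a
    unfolding F_def using d by (simp add: card_image strict_mono_imp_inj_on inj_on_subset)
  have F_mono: "F a \<subseteq> F b" if "a \<le> b" for a b
  proof -
    have "(h a)\<^sup>2 \<le> (h b)\<^sup>2" using monoD[OF h(1) that] by simp
    then show ?thesis unfolding F_def by (intro image_mono) simp
  qed
  obtain A where A: "\<And>a. a \<in> A \<longleftrightarrow>
      1 \<le> a \<and> h a \<le> card ((+) a ` F a - ((A \<inter> {..<a}) + D))"
    using online_set_exists[of "\<lambda>a X. 1 \<le> a \<and> h a \<le> card ((+) a ` F a - (X + D))"] by blast
  define New where "New a = (+) a ` F a - ((A \<inter> {..<a}) + D)" for a
  have New_fin [simp]: "finite (New a)" for a by (simp add: New_def)
  have New_D: "New a \<subseteq> {a} + D" for a using F_D by (auto simp: New_def set_plus_def)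
  have A1: "A \<subseteq> {1..}" using A by auto
  have h_mono: "h a \<le> h b" if "a \<le> b" for a b using monoD[OF h(1) that] .
  have h_pred: "filterlim (\<lambda>x. h x - 1) at_top sequentially"
    using filterlim_compose[OF filterlim_minus_const_nat_at_top h(2)] .

  \<comment> \<open>Each accepted \<open>a\<close> has at least \<open>h a\<close> private points
    \<open>New a\<close>, and for \<open>a \<le> x\<close> these lie in
    \<open>{1..2 * x}\<close>.\<close>
  have sum_h: "(\<Sum>a\<in>A \<inter> {1..x}. h a) \<le> 2 * x" for x
  proof -
    have "(\<Sum>a\<in>A \<inter> {1..x}. h a) \<le> (\<Sum>a\<in>A \<inter> {1..x}. card (New a))"
      using A by (intro sum_mono) (auto simp: New_def)
    also have "\<dots> = card (\<Union>a\<in>A \<inter> {1..x}. New a)"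
    proof (rule card_UN_disjoint[symmetric])
      have disj: "New a \<inter> New b = {}" if "a \<in> A" "a < b" for a b
      proof -
        have "New a \<subseteq> (A \<inter> {..<b}) + D"
          using New_D[of a] set_plus_mono2[of "{a}" "A \<inter> {..<b}" D D] that by auto
        then show ?thesis by (auto simp: New_def)
      qed
      show "\<forall>a\<in>A \<inter> {1..x}. \<forall>b\<in>A \<inter> {1..x}. a \<noteq> b \<longrightarrow> New a \<inter> New b = {}"
        using disj by (metis Int_commute Int_iff nat_neq_iff)
    qed auto
    also have "\<dots> \<le> card {1..2 * x}"
    proof (rule card_mono)
      show "(\<Union>a\<in>A \<inter> {1..x}. New a) \<subseteq> {1..2 * x}"
        using F_le by (fastforce simp: New_def)
    qed simp
    finally show ?thesis by simp
  qed
  \<comment> \<open>Split at \<open>n\<close>: the trivial count up to \<open>n\<close> costs at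
    most \<open>x\<close>, and beyond \<open>n\<close> each element has weight at least
    \<open>h x - 1\<close> in \<open>sum_h\<close>.\<close>
  have "(h x - 1) * card (A \<inter> {1..x}) \<le> 3 * x" for x
  proof -
    obtain n where n: "(h x - 1) * n \<le> x" "h x - 1 \<le> h n" using h(4) by blast
    have "(h x - 1) * card (A \<inter> {n<..x}) = (\<Sum>a\<in>A \<inter> {n<..x}. h x - 1)" by simp
    also have "\<dots> \<le> (\<Sum>a\<in>A \<inter> {n<..x}. h a)"
      using n(2) h_mono by (intro sum_mono) (meson IntD2 greaterThanAtMost_iff less_imp_le le_trans)
    also have "\<dots> \<le> (\<Sum>a\<in>A \<inter> {1..x}. h a)" by (intro sum_mono2) auto
    finally have 1: "(h x - 1) * card (A \<inter> {n<..x}) \<le> 2 * x" using sum_h[of x] by linarith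
    have "card (A \<inter> {1..x}) \<le> card ({1..n} \<union> (A \<inter> {n<..x}))" by (intro card_mono) auto
    also have "\<dots> \<le> n + card (A \<inter> {n<..x})" using card_Un_le[of "{1..n}" "A \<inter> {n<..x}"] by simp
    finally have "(h x - 1) * card (A \<inter> {1..x}) \<le> (h x - 1) * (n + card (A \<inter> {n<..x}))" by simp
    then show ?thesis using 1 n(1) by (simp add: distrib_left)
  qed
  then have A0: "has_asymptotic_density A 0"
    by (rule density_zero_if_slow_bound[OF h_pred])

  define W where "W = - (A + D)"
  \<comment> \<open>If \<open>a\<close> is accepted, all its translates are covered; if it is
    rejected, the test failed because fewer than \<open>h a\<close> were new.\<close>
  have few: "card (W \<inter> (+) a ` F a) \<le> h a" if "1 \<le> a" for a
  proof (cases "a \<in> A")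
    case True
    have "(+) a ` F a \<subseteq> A + D" using True F_D by (auto simp: set_plus_def)
    then have "W \<inter> (+) a ` F a = {}" by (auto simp: W_def)
    then show ?thesis by simp
  next
    case False
    have "(A \<inter> {..<a}) + D \<subseteq> A + D" by (intro set_plus_mono2) auto
    then have "W \<inter> (+) a ` F a \<subseteq> New a" by (auto simp: W_def New_def)
    then have "card (W \<inter> (+) a ` F a) \<le> card (New a)" by (intro card_mono) auto
    then show ?thesis using False A[of a] that by (simp add: New_def)
  qed
  have "(h x - 1) * card (W \<inter> {1..x}) \<le> 4 * x" for x
  proof (cases "h x \<le> 1")
    case True then show ?thesis by simp
  next
    case False
    obtain n where n: "(h x - 1) * n \<le> x" "h x - 1 \<le> h n" using h(4) by blast
    \<comment> \<open>For \<open>m > 2 * n\<close> and \<open>f \<le> n\<close> we get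
      \<open>m - f > n\<close>, so \<open>f\<close> is also among the translates tested at
      \<open>m - f\<close>. The discarded \<open>2 * n\<close> points cost at most
      \<open>2 * x\<close> after weighting.\<close>
    define V where "V = W \<inter> {2 * n<..x}"
    have V_fin: "finite V" by (simp add: V_def)
    \<comment> \<open>Double counting of the pairs \<open>(a, m)\<close> with \<open>m\<close> uncovered and \<open>m \<in> a + F a\<close>.\<close>
    have "card V * (h n)\<^sup>2 = card (V \<times> F n)" by (simp add: card_cartesian_product F_card)
    also have "\<dots> \<le> card (SIGMA a:{1..x}. W \<inter> (+) a ` F a)"
    proof (rule card_inj_on_le)
      show "inj_on (\<lambda>(m, f). (m - f, m)) (V \<times> F n)"
        using F_le by (fastforce simp: inj_on_def V_def)
      show "(\<lambda>(m, f). (m - f, m)) ` (V \<times> F n) \<subseteq> (SIGMA a:{1..x}. W \<inter> (+) a ` F a)"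
      proof clarify
        fix m f assume mf: "m \<in> V" "f \<in> F n"
        have "f \<le> n" "2 * n < m" "m \<le> x" "m \<in> W" using mf F_le by (auto simp: V_def)
        moreover from this have "f \<in> F (m - f)" using F_mono[of n "m - f"] mf(2)
          by (simp add: subset_iff)
        ultimately show "m - f \<in> {1..x} \<and> m \<in> W \<inter> (+) (m - f) ` F (m - f)"
          by (auto intro!: image_eqI[of _ _ f])
      qed
    qed auto
    also have "\<dots> = (\<Sum>a\<in>{1..x}. card (W \<inter> (+) a ` F a))" by (subst card_SigmaI) auto
    also have "\<dots> \<le> (\<Sum>a\<in>{1..x}. h x)"
      by (intro sum_mono) (meson atLeastAtMost_iff few h_mono le_trans)
    finally have "card V * (h n)\<^sup>2 \<le> x * h x" by simp
    moreover have "(h x - 1)\<^sup>2 \<le> (h n)\<^sup>2" using n(2) by simp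
    ultimately have "card V * (h x - 1)\<^sup>2 \<le> x * h x" by (meson le_trans mult_le_mono2)
    \<comment> \<open>Since \<open>h x \<ge> 2\<close>, one factor \<open>h x - 1\<close> can be
      cancelled.\<close>
    also have "\<dots> \<le> x * (2 * (h x - 1))" using False by (intro mult_le_mono2) simp
    finally have "(h x - 1) * (card V * (h x - 1)) \<le> (h x - 1) * (2 * x)"
      by (simp add: power2_eq_square ac_simps)
    then have V: "(h x - 1) * card V \<le> 2 * x" using False by (simp add: mult.commute)
    have "card (W \<inter> {1..x}) \<le> card ({1..2 * n} \<union> V)"
      using V_fin by (intro card_mono) (auto simp: V_def)
    also have "\<dots> \<le> 2 * n + card V" using card_Un_le[of "{1..2*n}" V] by simp
    finally have "(h x - 1) * card (W \<inter> {1..x}) \<le> (h x - 1) * (2 * n + card V)" by simp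
    also have "\<dots> = 2 * ((h x - 1) * n) + (h x - 1) * card V" by (simp add: distrib_left)
    finally show ?thesis using V n(1) by linarith
  qed
  then have "has_asymptotic_density W 0"
    by (rule density_zero_if_slow_bound[OF h_pred])
  with A0 A1 show thesis using that unfolding W_def by blast
qed

section \<open>Thinning to a prescribed density\<close>

text \<open>Used to find the last time the counting function is on a given side of the line of slope
  \<alpha>; from then on the greedy decision is constant.\<close>

lemma greatest_below:
  fixes P :: "nat \<Rightarrow> bool"
  assumes "P 0"
  obtains N where "N \<le> n" "P N" "\<And>m. N < m \<Longrightarrow> m \<le> n \<Longrightarrow> \<not> P m"
proof -
  let ?S = "{N. N \<le> n \<and> P N}"
  have fin: "finite ?S" and ne: "?S \<noteq> {}" using assms by auto
  show thesis
  proof (rule that)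
    show "Max ?S \<le> n" "P (Max ?S)" using Max_in[OF fin ne] by simp_all
    show "\<not> P m" if "Max ?S < m" "m \<le> n" for m
    proof
      assume "P m"
      then have "m \<le> Max ?S" using that(2) fin by (intro Max_ge) simp_all
      then show False using that(1) by simp
    qed
  qed
qed

lemma thinning_to_density:
  fixes A0 D :: "nat set" and \<alpha> :: real
  assumes D: "D \<subseteq> {1..}"
    and A0: "A0 \<subseteq> {1..}" "has_asymptotic_density A0 0"
    and W: "has_asymptotic_density (- (A0 + D)) 0"
    and sparse: "\<And>e. e > 0 \<Longrightarrow> \<exists>K. \<forall>\<^sub>F n in sequentially.
      card {m \<in> D. e * real n < real m \<and> m \<le> n} \<le> K"
    and \<alpha>: "0 \<le> \<alpha>" "\<alpha> \<le> 1"
  obtains A where "A \<subseteq> A0" "has_asymptotic_density (A + D) \<alpha>"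
proof -
  obtain A where A': "\<And>a. a \<in> A \<longleftrightarrow>
      a \<in> A0 \<and> real (card (((A \<inter> {..<a}) + D) \<inter> {1..a})) \<le> \<alpha> * real a"
    using online_set_exists[of
        "\<lambda>a X. a \<in> A0 \<and> real (card ((X + D) \<inter> {1..a})) \<le> \<alpha> * real a"] by blast
  define T where "T n = card ((A + D) \<inter> {1..n})" for n
  \<comment> \<open>Elements of \<open>D\<close> are positive, so sums up to \<open>a\<close> only
    use summands below \<open>a\<close>; the acceptance test therefore reads off the final
    set.\<close>
  have "((A \<inter> {..<a}) + D) \<inter> {1..a} = (A + D) \<inter> {1..a}" for a
    using D by (fastforce simp: set_plus_def)
  then have A: "a \<in> A \<longleftrightarrow> a \<in> A0 \<and> real (T a) \<le> \<alpha> * real a" for a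
    using A'[of a] by (simp add: T_def)
  have sub: "A \<subseteq> A0" using A by blast
  have T0: "T 0 = 0" by (simp add: T_def)
  have T_split: "T n = T N + card ((A + D) \<inter> {N<..n})" if "N \<le> n" for N n
  proof -
    have "(A + D) \<inter> {1..n} = (A + D) \<inter> {1..N} \<union> (A + D) \<inter> {N<..n}" using that by auto
    then show ?thesis unfolding T_def by (simp add: card_Un_disjoint disjoint_iff)
  qed
  have "has_asymptotic_density (A + D) \<alpha>"
  proof (rule has_asymptotic_densityI)
    fix e0 :: real assume "e0 > 0"
    \<comment> \<open>The lower bound loses \<open>e * n\<close> three times: by the delay, by
      points outside \<open>A0 + D\<close>, and by \<open>Far\<close>.\<close>
    define e where "e = e0 / 3"
    have e: "e > 0" "e0 = 3 * e" using \<open>e0 > 0\<close> by (simp_all add: e_def)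
    obtain K where K: "\<forall>\<^sub>F n in sequentially.
        card {m \<in> D. e * real n < real m \<and> m \<le> n} \<le> K" using sparse[OF e(1)] by blast
    \<comment> \<open>\<open>A0\<close> is taken so sparse that even \<open>K\<close> translates of
      it have at most \<open>e * n\<close> elements up to \<open>n\<close>; the +1 covers
      \<open>K = 0\<close>.\<close>
    have "e / (real K + 1) > 0" using e by simp
    from density_zeroD[OF A0(2) this] K density_zeroD[OF W e(1)]
    show "\<forall>\<^sub>F n in sequentially.
      \<bar>real (card ((A + D) \<inter> {1..n})) - \<alpha> * real n\<bar> \<le> e0 * real n"
    proof eventually_elim
      case (elim n)
      define Dn where "Dn = {m \<in> D. e * real n < real m \<and> m \<le> n}"
      \<comment> \<open>A sum up to \<open>n\<close> outside \<open>Far\<close> exceeds its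
        \<open>A0\<close>-summand by at most \<open>s\<close>.\<close>
      define Far where "Far = (A0 \<inter> {1..n}) + Dn"
      define s where "s = nat \<lfloor>e * real n\<rfloor>"
      have s: "real s \<le> e * real n" using e by (simp add: s_def)
      have s_less: "e * real n < real f" if "s < f" for f
        using that by (simp add: s_def) linarith
      have fin: "finite Dn" by (simp add: Dn_def)
      have Far_fin: "finite Far" unfolding Far_def using fin by (intro finite_set_plus) auto
      have "Far = (\<lambda>(a, f). a + f) ` ((A0 \<inter> {1..n}) \<times> Dn)"
        by (auto simp: Far_def set_plus_def)
      then have "card Far \<le> card (A0 \<inter> {1..n}) * card Dn"
        using card_image_le[of "(A0 \<inter> {1..n}) \<times> Dn" "\<lambda>(a, f). a + f"] fin
        by (simp add: card_cartesian_product)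
      also have "\<dots> \<le> card (A0 \<inter> {1..n}) * (K + 1)"
        using elim(2) by (intro mult_le_mono2) (simp add: Dn_def)
      finally have "real (card Far) \<le> card (A0 \<inter> {1..n}) * (real K + 1)"
        by (metis of_nat_1 of_nat_add of_nat_le_iff of_nat_mult)
      also have "\<dots> \<le> e / (real K + 1) * n * (real K + 1)"
        using elim(1) by (intro mult_right_mono) auto
      also have "\<dots> = e * n" by (simp add: field_simps)
      finally have Far: "real (card Far) \<le> e * n" .
      have FarI: "a + f \<in> Far" if "a \<in> A0" "f \<in> D" "s < f" "a + f \<le> n" for a f
        using that A0(1) s_less[of f] by (auto simp: Far_def Dn_def intro!: set_plus_intro)

      have upper: "real (T n) \<le> \<alpha> * n + 2 * (e * n)"
      proof -
        \<comment> \<open>After \<open>N\<close> nothing is accepted up to \<open>n\<close>.\<close>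
        obtain N where N: "N \<le> n" "real (T N) \<le> \<alpha> * N"
            "\<And>m. N < m \<Longrightarrow> m \<le> n \<Longrightarrow> \<not> real (T m) \<le> \<alpha> * m"
          using greatest_below[of "\<lambda>N. real (T N) \<le> \<alpha> * N" n] T0 by auto
        \<comment> \<open>Every accepted summand is at most \<open>N\<close>, so a sum outside
          \<open>Far\<close> stops by \<open>N + s\<close>.\<close>
        have "(A + D) \<inter> {N<..n} \<subseteq> {N<..N + s} \<union> Far"
        proof
          fix m assume m: "m \<in> (A + D) \<inter> {N<..n}"
          then obtain a f where af: "m = a + f" "a \<in> A" "f \<in> D" by (auto simp: set_plus_def)
          have "a \<le> N" using N(3)[of a] A[of a] af m by fastforce
          then show "m \<in> {N<..N + s} \<union> Far"
            using FarI[of a f] af m sub by (cases "s < f") auto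
        qed
        then have "card ((A + D) \<inter> {N<..n}) \<le> card ({N<..N + s} \<union> Far)"
          using Far_fin by (intro card_mono) auto
        also have "\<dots> \<le> s + card Far" using card_Un_le[of "{N<..N + s}" Far] by simp
        finally have "real (T n) \<le> \<alpha> * N + s + card Far" using T_split[OF N(1)] N(2) by linarith
        moreover have "\<alpha> * N \<le> \<alpha> * n" using \<alpha> N(1) by (simp add: mult_left_mono)
        ultimately show ?thesis using s Far by linarith
      qed

      have lower: "\<alpha> * n - 3 * (e * n) \<le> real (T n)"
      proof -
        \<comment> \<open>After \<open>N\<close> all of \<open>A0\<close> is accepted up to \<open>n\<close>.\<close>
        obtain N where N: "N \<le> n" "real (T N) \<ge> \<alpha> * N"
            "\<And>m. N < m \<Longrightarrow> m \<le> n \<Longrightarrow> \<not> real (T m) \<ge> \<alpha> * m"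
          using greatest_below[of "\<lambda>N. real (T N) \<ge> \<alpha> * N" n] T0 by auto
        let ?Y = "(A + D) \<inter> {N<..n}" and ?W = "- (A0 + D) \<inter> {1..n}"
        \<comment> \<open>A point of \<open>A0 + D\<close> beyond \<open>N + s\<close> and outside
          \<open>Far\<close> has its \<open>A0\<close>-summand above \<open>N\<close>, where it is
          accepted.\<close>
        have "{N<..n} \<subseteq> ?Y \<union> ({N<..N + s} \<union> (?W \<union> Far))"
        proof
          fix m assume m: "m \<in> {N<..n}"
          show "m \<in> ?Y \<union> ({N<..N + s} \<union> (?W \<union> Far))"
          proof (cases "m \<in> A0 + D \<and> N + s < m \<and> m \<notin> Far")
            case True
            then obtain a f where af: "m = a + f" "a \<in> A0" "f \<in> D" by (auto simp: set_plus_def)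
            then have "f \<le> s" using FarI[of a f] True m by fastforce
            then have "N < a" "a \<le> n" using True af m by auto
            then have "a \<in> A" using N(3)[of a] A[of a] af by auto
            then show ?thesis using af m by auto
          qed (use m in auto)
        qed
        then have "card {N<..n} \<le> card (?Y \<union> ({N<..N + s} \<union> (?W \<union> Far)))"
          using Far_fin by (intro card_mono) auto
        also have "\<dots> \<le> card ?Y + (s + (card ?W + card Far))"
          using card_Un_le[of ?Y "{N<..N + s} \<union> (?W \<union> Far)"]
            card_Un_le[of "{N<..N + s}" "?W \<union> Far"] card_Un_le[of ?W Far] by simp
        finally have "real n - real N \<le> card ?Y + s + card ?W + card Far" by simp
        \<comment> \<open>Up to the errors, \<open>T\<close> gains \<open>n - N\<close> after
          \<open>N\<close>; as \<alpha> \<le> 1 this keeps pace with the line.\<close>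
        moreover have "\<alpha> * (real n - real N) \<le> real n - real N"
          using \<alpha> N(1) by (simp add: mult_left_le_one_le)
        ultimately show ?thesis
          using T_split[OF N(1)] N(2) s Far elim(3) by (simp add: algebra_simps)
      qed
      have "e * n \<ge> 0" using e by simp
      then show ?case using upper lower e(2) unfolding T_def[symmetric] by (simp add: abs_le_iff)
    qed
  qed
  with sub show thesis using that by blast
qed

section \<open>Lacunarity and sparse windows\<close>

text \<open>From some index \<open>n0\<close> on, each step multiplies by at least
  \<open>q > 1\<close>, so \<open>r\<close> steps with \<open>q ^ r > L\<close> leave any window of
  ratio \<open>L\<close>. The first \<open>n0\<close> terms are added crudely.\<close>

lemma lacunary_card_bound:
  fixes B :: "nat set"
  assumes "infinite B" "B \<subseteq> {1..}"
    and "liminf (\<lambda>n. ereal (real (enumerate B (Suc n)) / real (enumerate B n))) > 1"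
  obtains K where "\<And>x. x \<ge> 0 \<Longrightarrow> card {b \<in> B. x < real b \<and> real b \<le> L * x} \<le> K"
proof -
  let ?b = "enumerate B"
  have mono_b: "strict_mono ?b" using assms(1) by (rule strict_mono_enumerate)
  have pos: "?b n > 0" for n using enumerate_in_set[OF assms(1), of n] assms(2) by auto
  \<comment> \<open>The liminf may be infinite; a value strictly between 1 and it is still a real
    number.\<close>
  obtain q' where q': "1 < q'" "q' < liminf (\<lambda>n. ereal (real (?b (Suc n)) / real (?b n)))"
    using dense[OF assms(3)] by blast
  then obtain q where q: "q' = ereal q" "q > 1" by (cases q') auto
  have "\<forall>\<^sub>F n in sequentially. q' < ereal (real (?b (Suc n)) / real (?b n))"
    using q'(2) less_LiminfD by blast
  then obtain n0 where n0: "\<And>n. n \<ge> n0 \<Longrightarrow> q < real (?b (Suc n)) / real (?b n)"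
    unfolding eventually_sequentially q by auto
  have step: "q * ?b n \<le> ?b (Suc n)" if "n \<ge> n0" for n
    using n0[OF that] pos[of n] by (simp add: field_simps)
  have steps: "q ^ r * ?b n \<le> ?b (n + r)" if "n \<ge> n0" for n r
  proof (induction r)
    case (Suc r)
    have "q ^ Suc r * ?b n = q * (q ^ r * ?b n)" by simp
    also have "\<dots> \<le> q * ?b (n + r)" using Suc q by simp
    also have "\<dots> \<le> ?b (Suc (n + r))" using step that by simp
    finally show ?case by simp
  qed simp
  obtain r where r: "L < q ^ r" using q real_arch_pow by blast
  show thesis
  proof (rule that[of "n0 + r"])
    fix x :: real assume x: "x \<ge> 0"
    define I where "I = {i. n0 \<le> i \<and> x < ?b i \<and> ?b i \<le> L * x}"
    have I: "\<exists>i. I \<subseteq> {i..<i + r}"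
    proof (cases "I = {}")
      case False
      define i where "i = (LEAST i. i \<in> I)"
      have i: "i \<in> I" unfolding i_def using False by (metis LeastI ex_in_conv)
      have "j < i + r" if "j \<in> I" for j
      proof (rule ccontr)
        assume "\<not> j < i + r"
        then have "real (?b (i + r)) \<le> ?b j" using mono_b by (simp add: strict_mono_less_eq)
        moreover have "q ^ r * ?b i \<le> ?b (i + r)" using steps i by (simp add: I_def)
        ultimately have 1: "q ^ r * ?b i \<le> L * x" using that by (simp add: I_def)
        have "x > 0" using x i pos[of i] by (cases "x = 0") (auto simp: I_def)
        have "L * x < q ^ r * x" using r \<open>x > 0\<close> by simp
        also have "\<dots> \<le> q ^ r * ?b i" using q i by (simp add: I_def)
        finally show False using 1 by simp
      qed
      moreover have "i \<le> j" if "j \<in> I" for j using that by (simp add: i_def Least_le)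
      ultimately show ?thesis by (intro exI[of _ i]) auto
    qed auto
    then obtain i where i: "I \<subseteq> {i..<i + r}" by blast
    have "{b \<in> B. x < real b \<and> real b \<le> L * x} \<subseteq> ?b ` ({..<n0} \<union> {i..<i + r})"
    proof
      fix b assume b: "b \<in> {b \<in> B. x < real b \<and> real b \<le> L * x}"
      then obtain j where "b = ?b j" using enumerate_Ex[OF assms(1)] by auto
      then show "b \<in> ?b ` ({..<n0} \<union> {i..<i + r})"
        using b subsetD[OF i, of j] by (cases "j < n0") (auto simp: I_def)
    qed
    then have "card {b \<in> B. x < real b \<and> real b \<le> L * x} \<le> card ({..<n0} \<union> {i..<i + r})"
      by (intro surj_card_le) auto
    also have "\<dots> \<le> n0 + r" using card_Un_le[of "{..<n0}" "{i..<i + r}"] by simp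
    finally show "card {b \<in> B. x < real b \<and> real b \<le> L * x} \<le> n0 + r" .
  qed
qed

text \<open>\<open>B + C\<close> need not be lacunary, but it inherits the window bound: once
  \<open>e / 2 * n\<close> is at least every element of \<open>C\<close>, a sum in
  \<open>(e * n, n]\<close> has its \<open>B\<close>-summand in \<open>(e / 2 * n, n]\<close>, a
  window of ratio \<open>2 / e\<close>.\<close>

lemma sumset_finite_sparse:
  fixes B C :: "nat set"
  assumes C: "finite C" and e: "e > 0"
    and bound: "\<And>x. x \<ge> 0 \<Longrightarrow> card {b \<in> B. x < real b \<and> real b \<le> 2 / e * x} \<le> K"
  shows "\<forall>\<^sub>F n in sequentially.
    card {m \<in> B + C. e * real n < real m \<and> m \<le> n} \<le> card C * K"
proof -
  obtain M where M: "\<And>c. c \<in> C \<Longrightarrow> c \<le> M" using C unfolding finite_nat_set_iff_bounded_le by auto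
  have "\<forall>\<^sub>F n in sequentially. n \<ge> nat \<lceil>2 * M / e\<rceil>" by (rule eventually_ge_at_top)
  then show ?thesis
  proof eventually_elim
    case (elim n)
    then have "2 * M / e \<le> n" by linarith
    then have n: "M \<le> e / 2 * n" using e by (simp add: field_simps)
    define Bn where "Bn = {b \<in> B. e / 2 * n < real b \<and> real b \<le> 2 / e * (e / 2 * n)}"
    have Bn: "Bn = {b \<in> B. e / 2 * n < real b \<and> b \<le> n}" using e by (simp add: Bn_def)
    have "{m \<in> B + C. e * real n < real m \<and> m \<le> n} \<subseteq> (\<lambda>(c, b). b + c) ` (C \<times> Bn)"
    proof
      fix m assume m: "m \<in> {m \<in> B + C. e * real n < real m \<and> m \<le> n}"
      then obtain b c where bc: "m = b + c" "b \<in> B" "c \<in> C" by (auto simp: set_plus_def)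
      have "real c \<le> e / 2 * n" using M[OF bc(3)] n by linarith
      then have "b \<in> Bn" using m bc by (auto simp: Bn)
      then show "m \<in> (\<lambda>(c, b). b + c) ` (C \<times> Bn)" using bc by auto
    qed
    moreover have "finite Bn" by (simp add: Bn)
    ultimately have "card {m \<in> B + C. e * real n < real m \<and> m \<le> n} \<le> card (C \<times> Bn)"
      using C by (intro surj_card_le) auto
    also have "\<dots> \<le> card C * K" using bound[of "e / 2 * n"] e
      by (simp add: card_cartesian_product Bn_def)
    finally show ?case .
  qed
qed

theorem corollary1p5:
  fixes B C :: "nat set" and \<alpha> :: real
  assumes "B \<subseteq> {1..}" and "infinite B"
    and "liminf (\<lambda>n. ereal (real (enumerate B (Suc n)) / real (enumerate B n))) > 1"
    and "C \<noteq> {}" and "finite C"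
    and "\<alpha> \<in> {0..1}"
  shows "\<exists>A. A \<subseteq> {1..} \<and> has_asymptotic_density A 0 \<and>
    has_asymptotic_density (A + B + C) \<alpha>"
proof -
  obtain c where c: "c \<in> C" using assms(4) by blast
  have D: "B + C \<subseteq> {1..}" using assms(1) by (fastforce simp: set_plus_def)
  have "(\<lambda>b. b + c) ` B \<subseteq> B + C" using c by auto
  moreover have "infinite ((\<lambda>b. b + c) ` B)" using assms(2) by (simp add: finite_image_iff)
  ultimately have D_inf: "infinite (B + C)" using finite_subset by blast
  obtain A0 where A0: "A0 \<subseteq> {1..}" "has_asymptotic_density A0 0"
      "has_asymptotic_density (- (A0 + (B + C))) 0"
    using thin_complement_exists[OF D D_inf] by blast
  have sparse: "\<exists>K. \<forall>\<^sub>F n in sequentially.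
      card {m \<in> B + C. e * real n < real m \<and> m \<le> n} \<le> K" if "e > 0" for e
  proof -
    obtain K where "\<And>x. x \<ge> 0 \<Longrightarrow> card {b \<in> B. x < real b \<and> real b \<le> 2 / e * x} \<le> K"
      using lacunary_card_bound[OF assms(2,1,3), of "2 / e"] by blast
    then show ?thesis using sumset_finite_sparse[OF assms(5) that] by blast
  qed
  obtain A where A: "A \<subseteq> A0" "has_asymptotic_density (A + (B + C)) \<alpha>"
    using thinning_to_density[OF D A0 sparse] assms(6) by auto
  have "has_asymptotic_density A 0"
  proof (rule has_asymptotic_densityI)
    fix e :: real assume "e > 0"
    from density_zeroD[OF A0(2) this]
    show "\<forall>\<^sub>F n in sequentially. \<bar>real (card (A \<inter> {1..n})) - 0 * real n\<bar> \<le> e * real n"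
    proof eventually_elim
      case (elim n)
      have "card (A \<inter> {1..n}) \<le> card (A0 \<inter> {1..n})" using A(1) by (intro card_mono) auto
      then show ?case using elim by simp
    qed
  qed
  then show ?thesis using A A0(1) by (auto simp: add.assoc)
qed

end
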